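(* Let $B$ be a $\lambda_f$-skew brace. Then the following are equivalent: (1) $B$ is finitely generated as a skew brace; (2) the group $(B,\circ)$ is finitely generated; (3) the group $(B,+)$ is finitely generated.
   Context: A skew brace is a triple $(B,+,\circ)$ where $(B,+)$ and $(B,\circ)$ are (not necessarily abelian) groups with $a\circ(b+c)=a\circ b-a+a\circ c$ for all $a,b,c\in B$, where $-a$ is the inverse of $a$ in $(B,+)$ and $\circ$ takes precedence over $+$. Put $\lambda_a(b)=-a+a\circ b$; then $a\mapsto\lambda_a$ is a group homomorphism $(B,\circ)\to\operatorname{Aut}(B,+)$. An element $x\in B$ is a $\lambda_f$-element if its orbit $[x]_\lambda=\{\lambda_a(x): a\in B\}$ is finite; $B$ is a $\lambda_f$-skew brace if all its elements are $\lambda_f$-elements. A sub skew brace is a subset that is a subgroup of both $(B,+)$ and $(B,\circ)$. $B$ is finitely generated as a skew brace if there is a finite subset $T\subseteq B$ such that the smallest sub skew brace of $B$ containing $T$ is $B$. *)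

theory Defs
  imports "HOL-Algebra.Algebra"
begin

text \<open>
  A skew brace is encoded in the ring record of \<^theory>\<open>HOL-Algebra.Ring\<close>, used purely as a
  signature: \<open>\<oplus>\<close> (with \<open>\<zero>\<close> and \<open>\<ominus>\<close>) is the possibly non-commutative additive operation, i.e.
  the operation of \<open>add_monoid B\<close>, and \<open>\<otimes>\<close> (with \<open>\<one>\<close> and \<open>inv\<close>) is the circle operation \<open>\<circ>\<close>.
  No ring axioms are assumed.
\<close>

locale skew_brace =
  fixes B :: "('a, 'm) ring_scheme" (structure)
  assumes add_group: "group (add_monoid B)"
    and circ_group: "group B"
    and circ_distrib:
      "\<lbrakk>a \<in> carrier B; b \<in> carrier B; c \<in> carrier B\<rbrakk>
        \<Longrightarrow> a \<otimes> (b \<oplus> c) = (a \<otimes> b \<ominus> a) \<oplus> a \<otimes> c"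

definition sb_lambda :: "('a, 'm) ring_scheme \<Rightarrow> 'a \<Rightarrow> 'a \<Rightarrow> 'a" where
  "sb_lambda B a b = \<ominus>\<^bsub>B\<^esub> a \<oplus>\<^bsub>B\<^esub> a \<otimes>\<^bsub>B\<^esub> b"

definition lambda_orbit :: "('a, 'm) ring_scheme \<Rightarrow> 'a \<Rightarrow> 'a set" where
  "lambda_orbit B x = (\<lambda>a. sb_lambda B a x) ` carrier B"

definition lambda_f_element :: "('a, 'm) ring_scheme \<Rightarrow> 'a \<Rightarrow> bool" where
  "lambda_f_element B x \<longleftrightarrow> x \<in> carrier B \<and> finite (lambda_orbit B x)"

locale lambda_f_skew_brace = skew_brace +
  assumes all_lambda_f: "x \<in> carrier B \<Longrightarrow> lambda_f_element B x"

definition sub_skew_brace :: "'a set \<Rightarrow> ('a, 'm) ring_scheme \<Rightarrow> bool" where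
  "sub_skew_brace H B \<longleftrightarrow> subgroup H (add_monoid B) \<and> subgroup H B"

definition sb_generate :: "('a, 'm) ring_scheme \<Rightarrow> 'a set \<Rightarrow> 'a set" where
  "sb_generate B T = \<Inter>{H. sub_skew_brace H B \<and> T \<subseteq> H}"

definition sb_finitely_generated :: "('a, 'm) ring_scheme \<Rightarrow> bool" where
  "sb_finitely_generated B \<longleftrightarrow>
    (\<exists>T. finite T \<and> T \<subseteq> carrier B \<and> sb_generate B T = carrier B)"

definition group_finitely_generated :: "('a, 'm) monoid_scheme \<Rightarrow> bool" where
  "group_finitely_generated G \<longleftrightarrow>
    (\<exists>T. finite T \<and> T \<subseteq> carrier G \<and> generate G T = carrier G)"

context skew_brace
begin

lemma sub_skew_brace_carrier: "sub_skew_brace (carrier B) B"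
  using group.subgroup_self[OF add_group] group.subgroup_self[OF circ_group]
  by (simp add: sub_skew_brace_def)

lemma sub_skew_brace_sb_generate:
  assumes "T \<subseteq> carrier B"
  shows "sub_skew_brace (sb_generate B T) B"
proof -
  let ?S = "{H. sub_skew_brace H B \<and> T \<subseteq> H}"
  have ne: "?S \<noteq> {}"
    using sub_skew_brace_carrier assms by blast
  have "subgroup (\<Inter>?S) (add_monoid B)"
    by (rule group.subgroups_Inter[OF add_group _ ne]) (simp add: sub_skew_brace_def)
  moreover have "subgroup (\<Inter>?S) B"
    by (rule group.subgroups_Inter[OF circ_group _ ne]) (simp add: sub_skew_brace_def)
  ultimately show ?thesis
    by (simp add: sub_skew_brace_def sb_generate_def)
qed

lemma subset_sb_generate: "T \<subseteq> sb_generate B T"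
  by (auto simp: sb_generate_def)

lemma sb_generate_least:
  assumes "sub_skew_brace H B" and "T \<subseteq> H"
  shows "sb_generate B T \<subseteq> H"
  using assms by (auto simp: sb_generate_def)

end

end

theory Submission
  imports Defs
begin

text \<open>
  Everything rests on rewriting one operation through the other along the action \<open>\<lambda>\<close>:
  \<open>a \<circ> b = a + \<lambda>\<^sub>a(b)\<close>, equivalently \<open>a + b = a \<circ> \<lambda>\<^sub>c(b)\<close>, where \<open>c\<close> is the circle inverse of \<open>a\<close>.
  So if a set \<open>Y\<close> is stable under all \<open>\<lambda>\<^sub>a\<close> and under additive inversion, right addition of an
  element of \<open>Y\<close> is the same as right circle multiplication by another element of \<open>Y\<close>, and the
  additive subgroup generated by \<open>Y\<close> is contained in the circle subgroup generated by \<open>Y\<close>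
  (\<open>add_generate_subset_circ_generate\<close>). The first identity also shows that the additive subgroup
  generated by a \<open>\<lambda>\<close>-stable set is closed under \<open>\<circ>\<close>, and hence is a sub skew brace
  (\<open>sub_skew_brace_add_generate\<close>).

  If \<open>T\<close> is a finite set that generates the skew brace, the union of the \<open>\<lambda>\<close>-orbits of the elements
  of \<open>T\<close> and of their additive inverses is stable in both senses, and it is finite because the
  orbits are. By the two facts above, this one finite set generates both groups. Conversely, a
  sub skew brace that contains generators of either group is everything.
\<close>

section \<open>The action of the circle group on the additive group\<close>

context skew_brace
begin

text \<open>
  With the rewrites the facts of the additive group are stated in ring notation. The simplifier
  normalizes the projections of \<open>add_monoid B\<close> to that notation, so unrewritten facts would no longer
  match its goals.
\<close>

sublocale plus: group "add_monoid B"
  rewrites "carrier (add_monoid B) = carrier B"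
    and "monoid.mult (add_monoid B) = (\<oplus>)"
    and "\<one>\<^bsub>add_monoid B\<^esub> = \<zero>"
    and "m_inv (add_monoid B) = a_inv B"
  by (simp_all add: add_group a_inv_def)

sublocale circ: group B
  by (rule circ_group)

abbreviation lam :: "'a \<Rightarrow> 'a \<Rightarrow> 'a" where
  "lam \<equiv> sb_lambda B"

text \<open>
  Distributivity at \<open>\<one> \<circ> (\<zero> + \<zero>)\<close> leaves \<open>\<zero> = - \<one>\<close>.
\<close>

lemma zero_eq_one: "\<zero> = \<one>"
proof -
  have "\<one> \<otimes> (\<zero> \<oplus> \<zero>) = (\<one> \<otimes> \<zero> \<ominus> \<one>) \<oplus> \<one> \<otimes> \<zero>"
    by (rule circ_distrib) auto
  then have "\<ominus> \<one> = \<zero>"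
    by (simp add: a_minus_def)
  then have "\<ominus> (\<ominus> \<one>) = \<ominus> \<zero>"
    by simp
  then show ?thesis
    by simp
qed

lemma lam_closed [simp]:
  assumes "a \<in> carrier B" "b \<in> carrier B"
  shows "lam a b \<in> carrier B"
  using assms by (simp add: sb_lambda_def)

lemma circ_eq_add_lam:
  assumes "a \<in> carrier B" "b \<in> carrier B"
  shows "a \<otimes> b = a \<oplus> lam a b"
  using assms by (simp add: sb_lambda_def plus.m_assoc [symmetric])

lemma lam_add:
  assumes "a \<in> carrier B" "b \<in> carrier B" "c \<in> carrier B"
  shows "lam a (b \<oplus> c) = lam a b \<oplus> lam a c"
  using assms by (simp add: sb_lambda_def circ_distrib a_minus_def plus.m_assoc)

lemma lam_zero:
  assumes "a \<in> carrier B"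
  shows "lam a \<zero> = \<zero>"
  using assms by (simp add: sb_lambda_def zero_eq_one)

lemma lam_minus:
  assumes "a \<in> carrier B" "b \<in> carrier B"
  shows "lam a (\<ominus> b) = \<ominus> lam a b"
proof (rule plus.inv_equality [symmetric])
  show "lam a (\<ominus> b) \<oplus> lam a b = \<zero>"
    using assms by (simp add: lam_zero flip: lam_add)
qed (use assms in auto)

lemma lam_circ:
  assumes "a \<in> carrier B" "b \<in> carrier B" "c \<in> carrier B"
  shows "lam (a \<otimes> b) c = lam a (lam b c)"
proof -
  have "lam a (lam b c) = lam a (\<ominus> b \<oplus> b \<otimes> c)"
    by (simp add: sb_lambda_def [of B b])
  also have "\<dots> = \<ominus> lam a b \<oplus> lam a (b \<otimes> c)"
    using assms by (simp add: lam_add lam_minus)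
  also have "\<dots> = \<ominus> (a \<otimes> b) \<oplus> a \<oplus> (\<ominus> a \<oplus> a \<otimes> (b \<otimes> c))"
    using assms by (simp add: sb_lambda_def plus.inv_mult_group)
  also have "\<dots> = lam (a \<otimes> b) c"
    using assms
    by (simp add: sb_lambda_def circ.m_assoc plus.m_assoc)
       (simp add: plus.m_assoc [symmetric])
  finally show ?thesis ..
qed

lemma lam_one:
  assumes "b \<in> carrier B"
  shows "lam \<one> b = b"
  using assms by (simp add: sb_lambda_def) (simp flip: zero_eq_one)

lemma add_eq_circ_lam_inv:
  assumes "a \<in> carrier B" "b \<in> carrier B"
  shows "a \<oplus> b = a \<otimes> lam (inv a) b"
proof -
  have "a \<otimes> lam (inv a) b = a \<oplus> lam a (lam (inv a) b)"
    using assms by (intro circ_eq_add_lam) auto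
  also have "lam a (lam (inv a) b) = b"
    using assms by (simp add: lam_one flip: lam_circ)
  finally show ?thesis ..
qed

section \<open>Generating sets stable under the action\<close>

definition lam_stable :: "'a set \<Rightarrow> bool" where
  "lam_stable Y \<longleftrightarrow> Y \<subseteq> carrier B \<and> (\<forall>a\<in>carrier B. \<forall>y\<in>Y. lam a y \<in> Y)"

lemma lam_stable_add_generate:
  assumes "lam_stable Y"
  shows "lam_stable (generate (add_monoid B) Y)"
proof -
  have Y: "Y \<subseteq> carrier B"
    using assms by (simp add: lam_stable_def)
  have "lam a h \<in> generate (add_monoid B) Y"
    if a: "a \<in> carrier B" and h: "h \<in> generate (add_monoid B) Y" for a h
    using h
  proof (induction rule: generate.induct)
    case one
    then show ?case
      using a generate.one [of "add_monoid B" Y] by (simp add: lam_zero)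
  next
    case (incl h)
    then show ?case
      using a assms by (auto simp: lam_stable_def intro: generate.incl)
  next
    case (inv h)
    then have "lam a h \<in> Y"
      using a assms by (auto simp: lam_stable_def)
    then have "\<ominus> lam a h \<in> generate (add_monoid B) Y"
      using generate.inv [of "lam a h" Y "add_monoid B"] by (simp add: a_inv_def)
    with inv a Y show ?case
      by (auto simp: lam_minus simp flip: a_inv_def)
  next
    case (eng h1 h2)
    then have "h1 \<in> carrier B" "h2 \<in> carrier B"
      using plus.generate_in_carrier [OF Y] by auto
    then show ?case
      using a eng generate.eng [OF eng.IH] by (simp add: lam_add)
  qed
  then show ?thesis
    using plus.generate_in_carrier [OF Y] by (auto simp: lam_stable_def)
qed

text \<open>
  Closure under circle inverses follows from \<open>\<zero> = inv h \<circ> h = inv h + \<lambda>\<^sub>c(h)\<close> with \<open>c = inv h\<close>, which exhibits \<open>inv h\<close>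
  as the additive inverse of an element of the \<open>\<lambda>\<close>-orbit of \<open>h\<close>.
\<close>

lemma sub_skew_brace_add_generate:
  assumes "lam_stable Y"
  shows "sub_skew_brace (generate (add_monoid B) Y) B"
proof -
  let ?H = "generate (add_monoid B) Y"
  have add: "subgroup ?H (add_monoid B)"
    using assms by (intro plus.generate_is_subgroup) (simp add: lam_stable_def)
  have stable: "lam a h \<in> ?H" if "a \<in> carrier B" "h \<in> ?H" for a h
    using that lam_stable_add_generate [OF assms] by (simp add: lam_stable_def)
  have carr: "h \<in> carrier B" if "h \<in> ?H" for h
    using that lam_stable_add_generate [OF assms] by (auto simp: lam_stable_def)
  have "subgroup ?H B"
  proof (rule circ.subgroupI)
    show "?H \<subseteq> carrier B"
      using carr by blast
    show "?H \<noteq> {}"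
      using generate.one by blast
    show "inv h \<in> ?H" if h: "h \<in> ?H" for h
    proof -
      have "inv h \<oplus> lam (inv h) h = \<zero>"
        using carr [OF h] by (simp add: zero_eq_one flip: circ_eq_add_lam)
      then have "inv h = \<ominus> lam (inv h) h"
        using carr [OF h] by (intro plus.inv_equality [symmetric]) auto
      moreover have "\<ominus> lam (inv h) h \<in> ?H"
        using subgroup.m_inv_closed [OF add stable] h carr [OF h] by (simp add: a_inv_def)
      ultimately show ?thesis
        by simp
    qed
    show "g \<otimes> h \<in> ?H" if "g \<in> ?H" "h \<in> ?H" for g h
      using subgroup.m_closed [OF add _ stable] that carr by (simp add: circ_eq_add_lam)
  qed
  with add show ?thesis
    by (simp add: sub_skew_brace_def)
qed

lemma add_generate_subset_circ_generate:
  assumes "lam_stable Y" and minus: "\<And>y. y \<in> Y \<Longrightarrow> \<ominus> y \<in> Y"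
  shows "generate (add_monoid B) Y \<subseteq> generate B Y"
proof -
  let ?K = "generate B Y"
  have Y: "Y \<subseteq> carrier B"
    using assms by (simp add: lam_stable_def)
  note carr = circ.generate_in_carrier [OF Y]
  have step: "a \<oplus> y \<in> ?K" if "a \<in> ?K" "y \<in> Y" for a y
  proof -
    have "lam (inv a) y \<in> Y"
      using assms(1) that carr by (simp add: lam_stable_def)
    then have "a \<otimes> lam (inv a) y \<in> ?K"
      using that(1) by (blast intro: generate.eng generate.incl)
    then show ?thesis
      using that carr Y by (simp add: add_eq_circ_lam_inv subset_iff)
  qed
  \<comment> \<open>Adding a generated element is a succession of steps, so the claim must hold for every starting
      point in \<open>?K\<close>, not only for \<open>\<zero>\<close>: the second summand of \<open>h1 \<oplus> h2\<close> starts where the first ends.\<close>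
  have translate: "\<forall>a\<in>?K. a \<oplus> h \<in> ?K" if "h \<in> generate (add_monoid B) Y" for h
    using that
  proof (induction rule: generate.induct)
    case one
    then show ?case
      using carr by simp
  next
    case (incl h)
    then show ?case
      using step by blast
  next
    case (inv h)
    then show ?case
      using step minus by (simp flip: a_inv_def)
  next
    case (eng h1 h2)
    then have "h1 \<in> carrier B" "h2 \<in> carrier B"
      using plus.generate_in_carrier [OF Y] by auto
    with eng show ?case
      using carr by (simp flip: plus.m_assoc)
  qed
  have "h \<in> ?K" if h: "h \<in> generate (add_monoid B) Y" for h
  proof -
    have "\<zero> \<in> ?K"
      using generate.one [of B Y] by (simp add: zero_eq_one)
    then have "\<zero> \<oplus> h \<in> ?K"
      using translate [OF h] by blast
    then show ?thesis
      using plus.generate_in_carrier [OF Y h] by simp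
  qed
  then show ?thesis
    by blast
qed

lemma self_in_lambda_orbit:
  assumes "x \<in> carrier B"
  shows "x \<in> lambda_orbit B x"
  unfolding lambda_orbit_def using lam_one [OF assms] by (intro image_eqI [of _ _ \<one>]) auto

lemma lam_stable_lambda_orbits:
  assumes "T \<subseteq> carrier B"
  shows "lam_stable (\<Union>x\<in>T. lambda_orbit B x)"
proof -
  have "lam a y \<in> lambda_orbit B x"
    if "a \<in> carrier B" "x \<in> T" "y \<in> lambda_orbit B x" for a x y
    using that assms by (auto simp: lambda_orbit_def subset_iff simp flip: lam_circ)
  moreover have "lambda_orbit B x \<subseteq> carrier B" if "x \<in> T" for x
    using that assms by (auto simp: lambda_orbit_def)
  ultimately show ?thesis
    by (fastforce simp: lam_stable_def)
qed

lemma minus_in_lambda_orbit: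
  assumes "x \<in> carrier B" "y \<in> lambda_orbit B x"
  shows "\<ominus> y \<in> lambda_orbit B (\<ominus> x)"
  using assms by (auto simp: lambda_orbit_def lam_minus)

section \<open>Comparing the three notions of finite generation\<close>

lemma sb_finitely_generated_if_circ:
  assumes "group_finitely_generated B"
  shows "sb_finitely_generated B"
proof -
  obtain T where T: "finite T" "T \<subseteq> carrier B" "generate B T = carrier B"
    using assms by (auto simp: group_finitely_generated_def)
  have S: "sub_skew_brace (sb_generate B T) B"
    using T(2) by (rule sub_skew_brace_sb_generate)
  then have "carrier B \<subseteq> sb_generate B T"
    using circ.generate_subgroup_incl [OF subset_sb_generate] T(3)
    by (auto simp: sub_skew_brace_def)
  moreover have "sb_generate B T \<subseteq> carrier B"
    using S by (simp add: sub_skew_brace_def subgroup.subset)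
  ultimately show ?thesis
    using T by (auto simp: sb_finitely_generated_def)
qed

lemma sb_finitely_generated_if_add:
  assumes "group_finitely_generated (add_monoid B)"
  shows "sb_finitely_generated B"
proof -
  obtain T where T: "finite T" "T \<subseteq> carrier B" "generate (add_monoid B) T = carrier B"
    using assms by (auto simp: group_finitely_generated_def)
  have S: "sub_skew_brace (sb_generate B T) B"
    using T(2) by (rule sub_skew_brace_sb_generate)
  then have "carrier B \<subseteq> sb_generate B T"
    using plus.generate_subgroup_incl [OF subset_sb_generate] T(3)
    by (auto simp: sub_skew_brace_def)
  moreover have "sb_generate B T \<subseteq> carrier B"
    using S by (simp add: sub_skew_brace_def subgroup.subset)
  ultimately show ?thesis
    using T by (auto simp: sb_finitely_generated_def)
qed

end

lemma (in lambda_f_skew_brace) finitely_generated_groups_if_sb: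
  assumes "sb_finitely_generated B"
  shows "group_finitely_generated B \<and> group_finitely_generated (add_monoid B)"
proof -
  obtain T where T: "finite T" "T \<subseteq> carrier B" "sb_generate B T = carrier B"
    using assms by (auto simp: sb_finitely_generated_def)
  \<comment> \<open>Additive inverses are adjoined before taking orbits: \<open>\<lambda>\<close> commutes with them, so \<open>Y\<close> is closed
      under both.\<close>
  define T' where "T' = T \<union> a_inv B ` T"
  define Y where "Y = (\<Union>x\<in>T'. lambda_orbit B x)"
  have T': "T' \<subseteq> carrier B" "finite T'"
    using T by (auto simp: T'_def)
  have minus_T': "\<ominus> x \<in> T'" if "x \<in> T'" for x
    using that T(2) by (auto simp: T'_def)
  have stable: "lam_stable Y"
    unfolding Y_def using T'(1) by (rule lam_stable_lambda_orbits)
  have minus: "\<ominus> y \<in> Y" if "y \<in> Y" for y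
    using that T'(1) minus_T' minus_in_lambda_orbit unfolding Y_def by blast
  have fin: "finite Y"
    using T' all_lambda_f by (auto simp: Y_def lambda_f_element_def)
  have Y: "Y \<subseteq> carrier B"
    using stable by (simp add: lam_stable_def)
  have "T \<subseteq> Y"
    using self_in_lambda_orbit T(2) by (auto simp: Y_def T'_def)
  then have "T \<subseteq> generate (add_monoid B) Y"
    by (auto intro: generate.incl)
  then have "carrier B \<subseteq> generate (add_monoid B) Y"
    using sb_generate_least [OF sub_skew_brace_add_generate [OF stable]] T(3) by blast
  moreover from this have "carrier B \<subseteq> generate B Y"
    using add_generate_subset_circ_generate [OF stable minus] by blast
  ultimately have "generate (add_monoid B) Y = carrier B" "generate B Y = carrier B"
    using plus.generate_in_carrier [OF Y] circ.generate_in_carrier [OF Y] by blast+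
  then show ?thesis
    using fin Y by (auto simp: group_finitely_generated_def)
qed

theorem theorem4p8:
  fixes B :: "('a, 'm) ring_scheme"
  assumes "lambda_f_skew_brace B"
  shows "(sb_finitely_generated B \<longleftrightarrow> group_finitely_generated B) \<and>
         (group_finitely_generated B \<longleftrightarrow> group_finitely_generated (add_monoid B))"
proof -
  interpret lambda_f_skew_brace B
    by (rule assms)
  show ?thesis
    using sb_finitely_generated_if_circ sb_finitely_generated_if_add
      finitely_generated_groups_if_sb by blast
qed

end
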